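(* Let $n\ge1$, let $a\in\mathcal E_n'$ and $b\in\pm\mathcal E_n$, and put $\chi=\gamma_n\frac{n(a)}{n(b)}\in\{\pm1\}$. Then $(a,b)$ is a zero divisor in $\mathcal A_{n+1}$, except for the following cases (in which it is not a zero divisor): (1) $n\le2$ and $\chi=-1$; (2) $b=\pm a$ and $\chi=\gamma_n=-1$; (3) $b=\pm e_0$ and $\chi=\gamma_n n(a)=-1$.
   Context: Real Cayley–Dickson algebras: $\mathcal A_0=\mathbb R$ with trivial involution. Given parameters $\gamma_0,\gamma_1,\dots\in\{\pm1\}$ (the paper's normalization of nonzero real parameters), $\mathcal A_{k+1}=\mathcal A_k\times\mathcal A_k$ with componentwise addition and real scaling, product $(a,b)(c,d)=(ac+\gamma_k\bar d b,\ da+b\bar c)$ and involution $\overline{(a,b)}=(\bar a,-b)$. The norm is $n(a)=a\bar a\in\mathbb R$. Standard basis: $e^{(0)}_0=1$; $e^{(k+1)}_j=(e^{(k)}_j,0)$ for $0\le j<2^k$ and $e^{(k+1)}_j=(0,e^{(k)}_{j-2^k})$ for $2^k\le j<2^{k+1}$; $e_0=e_0^{(n)}$ is the unity. Each standard basis element has norm $\pm1$. $\mathcal E_n=\{e^{(n)}_0,\dots,e^{(n)}_{2^n-1}\}$, $\mathcal E_n'=\mathcal E_n\setminus\{e_0^{(n)}\}$, $\pm\mathcal E_n=\mathcal E_n\cup(-\mathcal E_n)$. A zero divisor is a nonzero $x$ such that $xy=0$ or $yx=0$ for some $y\neq0$. *)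

theory Defs
  imports Complex_Main
begin

text \<open>Since the level is a variable, the algebras \<open>A\<^sub>k\<close> are carrier sets \<open>cd_carrier k\<close> in one type of
  formal nested pairs: \<open>cd_carrier k\<close> consists of the complete binary trees of height \<open>k\<close> with real
  leaves.  Operations on arguments of mismatched shape are left \<open>undefined\<close>.\<close>

datatype cd = CD_Real real | CD_Pair cd cd

primrec cd_carrier :: "nat \<Rightarrow> cd set" where
  "cd_carrier 0 = range CD_Real"
| "cd_carrier (Suc k) = {CD_Pair a b | a b. a \<in> cd_carrier k \<and> b \<in> cd_carrier k}"

primrec cd_zero :: "nat \<Rightarrow> cd" where
  "cd_zero 0 = CD_Real 0"
| "cd_zero (Suc k) = CD_Pair (cd_zero k) (cd_zero k)"

primrec cd_scale :: "real \<Rightarrow> cd \<Rightarrow> cd" where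
  "cd_scale r (CD_Real x) = CD_Real (r * x)"
| "cd_scale r (CD_Pair a b) = CD_Pair (cd_scale r a) (cd_scale r b)"

abbreviation cd_neg :: "cd \<Rightarrow> cd" where
  "cd_neg \<equiv> cd_scale (-1)"

fun cd_add :: "cd \<Rightarrow> cd \<Rightarrow> cd" where
  "cd_add (CD_Real x) (CD_Real y) = CD_Real (x + y)"
| "cd_add (CD_Pair a b) (CD_Pair c d) = CD_Pair (cd_add a c) (cd_add b d)"
| "cd_add _ _ = undefined"

primrec cd_conj :: "cd \<Rightarrow> cd" where
  "cd_conj (CD_Real x) = CD_Real x"
| "cd_conj (CD_Pair a b) = CD_Pair (cd_conj a) (cd_neg b)"

text \<open>The product of \<open>A\<^sub>k\<close>; the parameter \<open>\<gamma> k\<close> is the one used in passing from level \<open>k\<close> to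
  level \<open>Suc k\<close>.\<close>

fun cd_mult :: "(nat \<Rightarrow> real) \<Rightarrow> nat \<Rightarrow> cd \<Rightarrow> cd \<Rightarrow> cd" where
  "cd_mult \<gamma> 0 (CD_Real x) (CD_Real y) = CD_Real (x * y)"
| "cd_mult \<gamma> (Suc k) (CD_Pair a b) (CD_Pair c d) =
     CD_Pair
       (cd_add (cd_mult \<gamma> k a c) (cd_scale (\<gamma> k) (cd_mult \<gamma> k (cd_conj d) b)))
       (cd_add (cd_mult \<gamma> k d a) (cd_mult \<gamma> k b (cd_conj c)))"
| "cd_mult _ _ _ _ = undefined"

primrec cd_basis :: "nat \<Rightarrow> nat \<Rightarrow> cd" where
  "cd_basis 0 j = CD_Real 1"
| "cd_basis (Suc k) j =
     (if j < 2 ^ k then CD_Pair (cd_basis k j) (cd_zero k)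
      else CD_Pair (cd_zero k) (cd_basis k (j - 2 ^ k)))"

abbreviation cd_one :: "nat \<Rightarrow> cd" where
  "cd_one k \<equiv> cd_basis k 0"

definition cd_E :: "nat \<Rightarrow> cd set" where
  "cd_E k = cd_basis k ` {..<2 ^ k}"

definition cd_E' :: "nat \<Rightarrow> cd set" where
  "cd_E' k = cd_E k - {cd_one k}"

definition cd_pm_E :: "nat \<Rightarrow> cd set" where
  "cd_pm_E k = cd_E k \<union> cd_neg ` cd_E k"

text \<open>\<open>n(a)\<close> is the real number \<open>r\<close> with \<open>a (cd_conj a) = r e\<^sub>0\<close>, the reals being identified with the
  multiples of the unity.\<close>

definition cd_norm :: "(nat \<Rightarrow> real) \<Rightarrow> nat \<Rightarrow> cd \<Rightarrow> real" where
  "cd_norm \<gamma> k a = (THE r. cd_mult \<gamma> k a (cd_conj a) = cd_scale r (cd_one k))"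

definition cd_zero_divisor :: "(nat \<Rightarrow> real) \<Rightarrow> nat \<Rightarrow> cd \<Rightarrow> bool" where
  "cd_zero_divisor \<gamma> k x \<longleftrightarrow>
     x \<in> cd_carrier k \<and> x \<noteq> cd_zero k \<and>
     (\<exists>y \<in> cd_carrier k. y \<noteq> cd_zero k \<and>
        (cd_mult \<gamma> k x y = cd_zero k \<or> cd_mult \<gamma> k y x = cd_zero k))"

end

theory Submission
  imports Defs
begin

text \<open>Left and right multiplication by a basis element is invertible, with inverse given by the
  conjugate up to the norm, and two imaginary basis elements anticommute unless they agree up to sign.
  If \<open>\<chi> = 1\<close>, then \<open>x = (a, b)\<close> has norm \<open>0\<close> and is annihilated by its conjugate.  Let \<open>\<chi> = -1\<close>.  If
  \<open>n \<ge> 3\<close> and \<open>a, b\<close> are imaginary and distinct up to sign, then some imaginary basis element \<open>c\<close>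
  satisfies \<open>(ac)b = -a(cb)\<close>, and \<open>(a, b)\<close> annihilates \<open>(c, -n(a) (bc)a)\<close>.  In the exceptional cases
  the two equations expressing \<open>(a, b)(c, d) = 0\<close> can be solved for one another, by associativity
  if \<open>n \<le> 2\<close> and by flexibility if \<open>b = \<plusminus>a\<close>, and force \<open>c = d = 0\<close>.\<close>

subsection \<open>Linear structure, conjugation and product\<close>

lemma cd_zero_carrier [simp]: "cd_zero k \<in> cd_carrier k"
  by (induction k) auto

lemma cd_basis_carrier [simp]: "cd_basis k j \<in> cd_carrier k"
  by (induction k arbitrary: j) auto

lemma cd_scale_carrier [simp]: "x \<in> cd_carrier k \<Longrightarrow> cd_scale r x \<in> cd_carrier k"
  by (induction k arbitrary: x) auto

lemma cd_conj_carrier [simp]: "x \<in> cd_carrier k \<Longrightarrow> cd_conj x \<in> cd_carrier k"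
  by (induction k arbitrary: x) auto

lemma cd_add_carrier [simp]:
  "x \<in> cd_carrier k \<Longrightarrow> y \<in> cd_carrier k \<Longrightarrow> cd_add x y \<in> cd_carrier k"
  by (induction k arbitrary: x y) auto

lemma cd_mult_carrier [simp]:
  "x \<in> cd_carrier k \<Longrightarrow> y \<in> cd_carrier k \<Longrightarrow> cd_mult \<gamma> k x y \<in> cd_carrier k"
  by (induction k arbitrary: x y) auto

lemma cd_scale_scale [simp]: "cd_scale r (cd_scale s x) = cd_scale (r * s) x"
  by (induction x) auto

lemma cd_scale_one [simp]: "cd_scale 1 x = x"
  by (induction x) auto

lemma cd_scale_zero [simp]: "cd_scale r (cd_zero k) = cd_zero k"
  by (induction k) auto

lemma cd_scale_0: "x \<in> cd_carrier k \<Longrightarrow> cd_scale 0 x = cd_zero k"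
  by (induction k arbitrary: x) auto

lemma cd_conj_zero [simp]: "cd_conj (cd_zero k) = cd_zero k"
  by (induction k) auto

lemma cd_conj_one [simp]: "cd_conj (cd_one k) = cd_one k"
  by (induction k) auto

lemma cd_conj_scale [simp]: "cd_conj (cd_scale r x) = cd_scale r (cd_conj x)"
  by (induction x) auto

lemma cd_conj_conj [simp]: "cd_conj (cd_conj x) = x"
  by (induction x) auto

lemma cd_add_zero_left [simp]: "x \<in> cd_carrier k \<Longrightarrow> cd_add (cd_zero k) x = x"
  by (induction k arbitrary: x) auto

lemma cd_add_zero_right [simp]: "x \<in> cd_carrier k \<Longrightarrow> cd_add x (cd_zero k) = x"
  by (induction k arbitrary: x) auto

lemma cd_add_commute:
  "x \<in> cd_carrier k \<Longrightarrow> y \<in> cd_carrier k \<Longrightarrow> cd_add x y = cd_add y x"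
  by (induction k arbitrary: x y) auto

lemma cd_scale_add:
  "x \<in> cd_carrier k \<Longrightarrow> y \<in> cd_carrier k \<Longrightarrow>
    cd_scale r (cd_add x y) = cd_add (cd_scale r x) (cd_scale r y)"
  by (induction k arbitrary: x y) (auto simp: algebra_simps)

lemma cd_conj_add:
  "x \<in> cd_carrier k \<Longrightarrow> y \<in> cd_carrier k \<Longrightarrow>
    cd_conj (cd_add x y) = cd_add (cd_conj x) (cd_conj y)"
  by (induction k arbitrary: x y) (auto simp: cd_scale_add)

lemma cd_add_eq_zero_iff:
  "x \<in> cd_carrier k \<Longrightarrow> y \<in> cd_carrier k \<Longrightarrow> cd_add x y = cd_zero k \<longleftrightarrow> x = cd_neg y"
  by (induction k arbitrary: x y) auto

lemma cd_scale_eq_zero_iff: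
  "x \<in> cd_carrier k \<Longrightarrow> cd_scale r x = cd_zero k \<longleftrightarrow> r = 0 \<or> x = cd_zero k"
  by (induction k arbitrary: x) auto

lemma cd_conj_eq_zero_iff:
  "x \<in> cd_carrier k \<Longrightarrow> cd_conj x = cd_zero k \<longleftrightarrow> x = cd_zero k"
  by (metis cd_conj_conj cd_conj_zero)

lemma cd_one_neq_zero [simp]: "cd_one k \<noteq> cd_zero k"
  by (induction k) auto

text \<open>Makes the real number in the definite description of \<open>cd_norm\<close>
  unique.\<close>

lemma cd_scale_cancel_left:
  "x \<in> cd_carrier k \<Longrightarrow> x \<noteq> cd_zero k \<Longrightarrow> cd_scale r x = cd_scale s x \<longleftrightarrow> r = s"
  by (induction k arbitrary: x) auto

text \<open>The proofs that (a, b) is not a zero divisor all end with an element equal to its own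
  negative.\<close>

lemma cd_neg_eq_self_iff: "x \<in> cd_carrier k \<Longrightarrow> x = cd_neg x \<longleftrightarrow> x = cd_zero k"
  by (induction k arbitrary: x) auto

text \<open>The two laws need a joint induction: in da and (conj d)b the components of the left and
  right factor have changed sides.\<close>

lemma cd_mult_scale_left [simp]:
  "x \<in> cd_carrier k \<Longrightarrow> y \<in> cd_carrier k \<Longrightarrow>
    cd_mult \<gamma> k (cd_scale r x) y = cd_scale r (cd_mult \<gamma> k x y)"
  and cd_mult_scale_right [simp]:
  "x \<in> cd_carrier k \<Longrightarrow> y \<in> cd_carrier k \<Longrightarrow>
    cd_mult \<gamma> k x (cd_scale r y) = cd_scale r (cd_mult \<gamma> k x y)"
proof (induction k arbitrary: x y)
  case (Suc k)
  {
    case 1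
    with Suc show ?case
      by (auto simp: cd_scale_add[where k = k] mult.commute)
  next
    case 2
    with Suc show ?case
      by (auto simp: cd_scale_add[where k = k] mult.commute)
  }
qed auto

lemma cd_mult_zero_left [simp]:
  "x \<in> cd_carrier k \<Longrightarrow> cd_mult \<gamma> k (cd_zero k) x = cd_zero k"
  by (metis cd_mult_carrier cd_mult_scale_left cd_scale_0 cd_zero_carrier)

lemma cd_mult_zero_right [simp]:
  "x \<in> cd_carrier k \<Longrightarrow> cd_mult \<gamma> k x (cd_zero k) = cd_zero k"
  by (metis cd_mult_carrier cd_mult_scale_right cd_scale_0 cd_zero_carrier)

lemma cd_mult_one_left [simp]: "x \<in> cd_carrier k \<Longrightarrow> cd_mult \<gamma> k (cd_one k) x = x"
  and cd_mult_one_right [simp]: "x \<in> cd_carrier k \<Longrightarrow> cd_mult \<gamma> k x (cd_one k) = x"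
  by (induction k arbitrary: x) auto

lemma cd_conj_mult:
  "x \<in> cd_carrier k \<Longrightarrow> y \<in> cd_carrier k \<Longrightarrow>
    cd_conj (cd_mult \<gamma> k x y) = cd_mult \<gamma> k (cd_conj y) (cd_conj x)"
proof (induction k arbitrary: x y)
  case (Suc k)
  then obtain a b c d where "x = CD_Pair a b" "y = CD_Pair c d"
    "a \<in> cd_carrier k" "b \<in> cd_carrier k" "c \<in> cd_carrier k" "d \<in> cd_carrier k"
    by auto
  \<comment> \<open>After simplification the two summands of the second component stand in opposite
    orders, so commutativity of addition remains.\<close>
  with Suc.IH show ?case
    by (simp add: cd_conj_add[where k = k] cd_scale_add[where k = k])
      (rule cd_add_commute[where k = k]; simp)
qed auto

text \<open>A signed basis element of level \<open>Suc k\<close> has a zero component. This rule and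
  the next three replace \<open>cd_mult.simps\<close> for such factors, so that each component of a
  product is a single term.\<close>

lemma cd_mult_Pair_zero_left:
  assumes "p \<in> cd_carrier k" "c \<in> cd_carrier k" "d \<in> cd_carrier k"
  shows "cd_mult \<gamma> (Suc k) (CD_Pair p (cd_zero k)) (CD_Pair c d) =
    CD_Pair (cd_mult \<gamma> k p c) (cd_mult \<gamma> k d p)"
  using assms by simp

lemma cd_mult_zero_Pair_left:
  assumes "p \<in> cd_carrier k" "c \<in> cd_carrier k" "d \<in> cd_carrier k"
  shows "cd_mult \<gamma> (Suc k) (CD_Pair (cd_zero k) p) (CD_Pair c d) =
    CD_Pair (cd_scale (\<gamma> k) (cd_mult \<gamma> k (cd_conj d) p)) (cd_mult \<gamma> k p (cd_conj c))"
  using assms by simp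

lemma cd_mult_Pair_zero_right:
  assumes "p \<in> cd_carrier k" "c \<in> cd_carrier k" "d \<in> cd_carrier k"
  shows "cd_mult \<gamma> (Suc k) (CD_Pair c d) (CD_Pair p (cd_zero k)) =
    CD_Pair (cd_mult \<gamma> k c p) (cd_mult \<gamma> k d (cd_conj p))"
  using assms by simp

lemma cd_mult_zero_Pair_right:
  assumes "p \<in> cd_carrier k" "c \<in> cd_carrier k" "d \<in> cd_carrier k"
  shows "cd_mult \<gamma> (Suc k) (CD_Pair c d) (CD_Pair (cd_zero k) p) =
    CD_Pair (cd_scale (\<gamma> k) (cd_mult \<gamma> k (cd_conj p) d)) (cd_mult \<gamma> k p c)"
  using assms by simp

subsection \<open>Signed basis elements\<close>

lemma cd_pm_E_0: "cd_pm_E 0 = {CD_Real 1, CD_Real (-1)}"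
  by (auto simp: cd_pm_E_def cd_E_def lessThan_Suc)

lemma cd_E_Suc:
  "cd_E (Suc k) =
    (\<lambda>p. CD_Pair p (cd_zero k)) ` cd_E k \<union> (\<lambda>p. CD_Pair (cd_zero k) p) ` cd_E k"
proof -
  have "{..<2 ^ Suc k} = {..<2 ^ k} \<union> (\<lambda>j. j + 2 ^ k) ` {..<2 ^ k :: nat}"
  proof (intro equalityI subsetI)
    fix j :: nat
    assume "j \<in> {..<2 ^ Suc k}"
    then show "j \<in> {..<2 ^ k} \<union> (\<lambda>j. j + 2 ^ k) ` {..<2 ^ k}"
      by (cases "j < 2 ^ k") (auto intro!: image_eqI[of _ _ "j - 2 ^ k"])
  qed auto
  then show ?thesis
    unfolding cd_E_def
    by (simp only: image_Un image_image) (simp cong: image_cong_simp)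
qed

lemma cd_pm_E_Suc:
  "cd_pm_E (Suc k) =
    (\<lambda>p. CD_Pair p (cd_zero k)) ` cd_pm_E k \<union> (\<lambda>p. CD_Pair (cd_zero k) p) ` cd_pm_E k"
  by (simp add: cd_pm_E_def cd_E_Suc image_Un image_image) blast

lemma cd_pm_E_Pair_zero: "p \<in> cd_pm_E k \<Longrightarrow> CD_Pair p (cd_zero k) \<in> cd_pm_E (Suc k)"
  and cd_pm_E_zero_Pair: "p \<in> cd_pm_E k \<Longrightarrow> CD_Pair (cd_zero k) p \<in> cd_pm_E (Suc k)"
  by (simp_all add: cd_pm_E_Suc)

lemma cd_pm_E_carrier: "p \<in> cd_pm_E k \<Longrightarrow> p \<in> cd_carrier k"
  by (auto simp: cd_pm_E_def cd_E_def)

lemma cd_one_pm_E [simp]: "cd_one k \<in> cd_pm_E k"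
  by (auto simp: cd_pm_E_def cd_E_def)

lemma cd_neg_pm_E [simp]: "p \<in> cd_pm_E k \<Longrightarrow> cd_neg p \<in> cd_pm_E k"
  by (auto simp: cd_pm_E_def)

lemma cd_pm_E_neq_zero: "p \<in> cd_pm_E k \<Longrightarrow> p \<noteq> cd_zero k"
  by (induction k arbitrary: p) (auto simp: cd_pm_E_0 cd_pm_E_Suc)

lemma cd_pm_E_real_or_imag:
  "p \<in> cd_pm_E k \<Longrightarrow> p = cd_one k \<or> p = cd_neg (cd_one k) \<or> cd_conj p = cd_neg p"
proof (induction k arbitrary: p)
  case (Suc k)
  then show ?case by (fastforce simp: cd_pm_E_Suc)
qed (auto simp: cd_pm_E_0)

lemma cd_conj_pm_E [simp]: "p \<in> cd_pm_E k \<Longrightarrow> cd_conj p \<in> cd_pm_E k"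
  by (induction k arbitrary: p) (auto simp: cd_pm_E_0 cd_pm_E_Suc)

section \<open>Products, inverses and flexibility of signed basis elements\<close>

lemma cd_mult_pm_E:
  assumes \<gamma>: "range \<gamma> \<subseteq> {1, -1}"
  shows "p \<in> cd_pm_E k \<Longrightarrow> q \<in> cd_pm_E k \<Longrightarrow> cd_mult \<gamma> k p q \<in> cd_pm_E k"
proof (induction k arbitrary: p q)
  case (Suc k)
  have "cd_scale (\<gamma> k) x \<in> cd_pm_E k" if "x \<in> cd_pm_E k" for x
    using range_subsetD[OF \<gamma>, of k] that by auto
  with Suc show ?case
    by (auto simp: cd_pm_E_Suc cd_pm_E_carrier)
qed (auto simp: cd_pm_E_0)

text \<open>Passing from q to (q, 0) keeps the norm, passing to (0, q) multiplies it by
  -\<open>\<gamma> k\<close>. The four identities share one induction because (0, q) moves q to the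
  other side of a component: the right laws for (0, q) come from the left laws for q. The scalar is
  existential here, since its identification with \<open>cd_norm\<close> already uses such an
  identity.\<close>

lemma cd_pm_E_inverse:
  assumes \<gamma>: "range \<gamma> \<subseteq> {1, -1}" and "p \<in> cd_pm_E k"
  shows "\<exists>\<nu>\<in>{1, -1}. \<forall>y\<in>cd_carrier k.
    cd_mult \<gamma> k (cd_mult \<gamma> k y p) (cd_conj p) = cd_scale \<nu> y \<and>
    cd_mult \<gamma> k (cd_mult \<gamma> k y (cd_conj p)) p = cd_scale \<nu> y \<and>
    cd_mult \<gamma> k (cd_conj p) (cd_mult \<gamma> k p y) = cd_scale \<nu> y \<and>
    cd_mult \<gamma> k p (cd_mult \<gamma> k (cd_conj p) y) = cd_scale \<nu> y"
  using assms(2)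
proof (induction k arbitrary: p)
  case 0
  then show ?case by (auto simp: cd_pm_E_0)
next
  case (Suc k)
  from Suc.prems obtain q where q: "q \<in> cd_pm_E k"
    and p: "p = CD_Pair q (cd_zero k) \<or> p = CD_Pair (cd_zero k) q"
    by (auto simp: cd_pm_E_Suc)
  have [simp]: "q \<in> cd_carrier k" using q by (rule cd_pm_E_carrier)
  from Suc.IH[OF q] obtain \<nu> where \<nu>: "\<nu> \<in> {1, -1}"
    and IH: "\<And>y. y \<in> cd_carrier k \<Longrightarrow>
      cd_mult \<gamma> k (cd_mult \<gamma> k y q) (cd_conj q) = cd_scale \<nu> y"
      "\<And>y. y \<in> cd_carrier k \<Longrightarrow>
      cd_mult \<gamma> k (cd_mult \<gamma> k y (cd_conj q)) q = cd_scale \<nu> y"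
      "\<And>y. y \<in> cd_carrier k \<Longrightarrow>
      cd_mult \<gamma> k (cd_conj q) (cd_mult \<gamma> k q y) = cd_scale \<nu> y"
      "\<And>y. y \<in> cd_carrier k \<Longrightarrow>
      cd_mult \<gamma> k q (cd_mult \<gamma> k (cd_conj q) y) = cd_scale \<nu> y"
    by blast
  from p show ?case
  proof
    assume "p = CD_Pair q (cd_zero k)"
    with \<nu> IH show ?thesis
      by (intro bexI[of _ \<nu>]) (auto simp: cd_mult_Pair_zero_left cd_mult_Pair_zero_right
          simp del: cd_mult.simps)
  next
    assume "p = CD_Pair (cd_zero k) q"
    moreover have "- (\<gamma> k * \<nu>) \<in> {1, -1}" using \<nu> range_subsetD[OF \<gamma>, of k] by auto
    ultimately show ?thesis using IH
      by (intro bexI[of _ "- (\<gamma> k * \<nu>)"]) (auto simp: cd_mult_zero_Pair_left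
          cd_mult_zero_Pair_right cd_conj_mult simp del: cd_mult.simps)
  qed
qed

lemma cd_norm_pm_E:
  assumes \<gamma>: "range \<gamma> \<subseteq> {1, -1}" and p: "p \<in> cd_pm_E k"
  shows "cd_norm \<gamma> k p \<in> {1, -1}"
    and "y \<in> cd_carrier k \<Longrightarrow>
      cd_mult \<gamma> k (cd_mult \<gamma> k y p) (cd_conj p) = cd_scale (cd_norm \<gamma> k p) y"
    and "y \<in> cd_carrier k \<Longrightarrow>
      cd_mult \<gamma> k (cd_mult \<gamma> k y (cd_conj p)) p = cd_scale (cd_norm \<gamma> k p) y"
    and "y \<in> cd_carrier k \<Longrightarrow>
      cd_mult \<gamma> k (cd_conj p) (cd_mult \<gamma> k p y) = cd_scale (cd_norm \<gamma> k p) y"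
    and "y \<in> cd_carrier k \<Longrightarrow>
      cd_mult \<gamma> k p (cd_mult \<gamma> k (cd_conj p) y) = cd_scale (cd_norm \<gamma> k p) y"
proof -
  obtain \<nu> where \<nu>: "\<nu> \<in> {1, -1}" and inv: "\<forall>y\<in>cd_carrier k.
    cd_mult \<gamma> k (cd_mult \<gamma> k y p) (cd_conj p) = cd_scale \<nu> y \<and>
    cd_mult \<gamma> k (cd_mult \<gamma> k y (cd_conj p)) p = cd_scale \<nu> y \<and>
    cd_mult \<gamma> k (cd_conj p) (cd_mult \<gamma> k p y) = cd_scale \<nu> y \<and>
    cd_mult \<gamma> k p (cd_mult \<gamma> k (cd_conj p) y) = cd_scale \<nu> y"
    using cd_pm_E_inverse[OF \<gamma> p] by blast
  \<comment> \<open>Taking y = 1 identifies the scalar as the norm.\<close>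
  have "cd_mult \<gamma> k p (cd_conj p) = cd_scale \<nu> (cd_one k)"
    using inv[rule_format, of "cd_one k"] cd_pm_E_carrier[OF p] by simp
  then have "cd_norm \<gamma> k p = \<nu>"
    unfolding cd_norm_def by (auto simp: cd_scale_cancel_left[where k = k])
  then show "cd_norm \<gamma> k p \<in> {1, -1}"
    and "y \<in> cd_carrier k \<Longrightarrow>
      cd_mult \<gamma> k (cd_mult \<gamma> k y p) (cd_conj p) = cd_scale (cd_norm \<gamma> k p) y"
    and "y \<in> cd_carrier k \<Longrightarrow>
      cd_mult \<gamma> k (cd_mult \<gamma> k y (cd_conj p)) p = cd_scale (cd_norm \<gamma> k p) y"
    and "y \<in> cd_carrier k \<Longrightarrow>
      cd_mult \<gamma> k (cd_conj p) (cd_mult \<gamma> k p y) = cd_scale (cd_norm \<gamma> k p) y"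
    and "y \<in> cd_carrier k \<Longrightarrow>
      cd_mult \<gamma> k p (cd_mult \<gamma> k (cd_conj p) y) = cd_scale (cd_norm \<gamma> k p) y"
    using \<nu> inv by (simp_all only:)
qed

text \<open>The inverse laws with conj p = -p inserted; since pp = -n(p), these are instances of the
  two alternative laws.\<close>

lemma cd_pm_E_alternative:
  assumes \<gamma>: "range \<gamma> \<subseteq> {1, -1}" and p: "p \<in> cd_pm_E k" "cd_conj p = cd_neg p"
    and y: "y \<in> cd_carrier k"
  shows "cd_mult \<gamma> k (cd_mult \<gamma> k y p) p = cd_scale (- cd_norm \<gamma> k p) y"
    and "cd_mult \<gamma> k p (cd_mult \<gamma> k p y) = cd_scale (- cd_norm \<gamma> k p) y"
proof -
  note [simp] = cd_pm_E_carrier[OF p(1)] y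
  have "cd_neg (cd_mult \<gamma> k (cd_mult \<gamma> k y p) p) = cd_scale (cd_norm \<gamma> k p) y"
    using cd_norm_pm_E(2)[OF \<gamma> p(1) y] p(2) by simp
  from arg_cong[OF this, of cd_neg]
  show "cd_mult \<gamma> k (cd_mult \<gamma> k y p) p = cd_scale (- cd_norm \<gamma> k p) y"
    by simp
  have "cd_neg (cd_mult \<gamma> k p (cd_mult \<gamma> k p y)) = cd_scale (cd_norm \<gamma> k p) y"
    using cd_norm_pm_E(4)[OF \<gamma> p(1) y] p(2) by simp
  from arg_cong[OF this, of cd_neg]
  show "cd_mult \<gamma> k p (cd_mult \<gamma> k p y) = cd_scale (- cd_norm \<gamma> k p) y"
    by simp
qed

text \<open>The induction hypothesis is needed only in the first component for p = (q, 0). Elsewhere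
  the two sides either coincide or both reduce, by the inverse laws for q, to the same multiple of d
  or of conj c.\<close>

lemma cd_pm_E_flexible:
  assumes \<gamma>: "range \<gamma> \<subseteq> {1, -1}"
  shows "p \<in> cd_pm_E k \<Longrightarrow> y \<in> cd_carrier k \<Longrightarrow>
    cd_mult \<gamma> k (cd_mult \<gamma> k p y) p = cd_mult \<gamma> k p (cd_mult \<gamma> k y p)"
proof (induction k arbitrary: p y)
  case 0
  then show ?case by (auto simp: cd_pm_E_0)
next
  case (Suc k)
  from Suc.prems obtain q c d where q: "q \<in> cd_pm_E k"
    and p: "p = CD_Pair q (cd_zero k) \<or> p = CD_Pair (cd_zero k) q"
    and y: "y = CD_Pair c d" and [simp]: "c \<in> cd_carrier k" "d \<in> cd_carrier k"
    by (auto simp: cd_pm_E_Suc)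
  have [simp]: "q \<in> cd_carrier k" using q by (rule cd_pm_E_carrier)
  note inv = cd_norm_pm_E[OF \<gamma> q]
  from p show ?case
  proof
    assume "p = CD_Pair q (cd_zero k)"
    with y show ?thesis
      by (simp add: cd_mult_Pair_zero_left cd_mult_Pair_zero_right inv Suc.IH q
          del: cd_mult.simps)
  next
    assume "p = CD_Pair (cd_zero k) q"
    with y show ?thesis
      by (simp add: cd_mult_zero_Pair_left cd_mult_zero_Pair_right cd_conj_mult inv Suc.IH q
          del: cd_mult.simps)
  qed
qed

text \<open>The product of imaginary basis elements is again a basis element and is
  imaginary unless \<open>p = \<plusminus>q\<close>; conjugating it reverses the factors.\<close>

lemma cd_pm_E_anticommute:
  assumes \<gamma>: "range \<gamma> \<subseteq> {1, -1}" and p: "p \<in> cd_pm_E k" "cd_conj p = cd_neg p"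
    and q: "q \<in> cd_pm_E k" "cd_conj q = cd_neg q" and "p \<noteq> q" "p \<noteq> cd_neg q"
  shows "cd_mult \<gamma> k p q = cd_neg (cd_mult \<gamma> k q p)"
proof -
  note [simp] = cd_pm_E_carrier[OF p(1)] cd_pm_E_carrier[OF q(1)]
  have conj: "cd_conj (cd_mult \<gamma> k q p) = cd_mult \<gamma> k p q"
    using p q by (simp add: cd_conj_mult)
  \<comment> \<open>If qp = s is real, right multiplication by p gives -n(p) q = s p, so p and q
    agree up to sign.\<close>
  have False if "cd_mult \<gamma> k q p = cd_scale s (cd_one k)" "s \<in> {1, -1}" for s
  proof -
    let ?r = "- cd_norm \<gamma> k p"
    have r: "?r \<in> {1, -1}" using cd_norm_pm_E(1)[OF \<gamma> p(1)] by auto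
    have "cd_scale ?r q = cd_scale s p"
      using cd_pm_E_alternative(1)[OF \<gamma> p, of q] that(1) by simp
    then have "cd_scale s (cd_scale ?r q) = cd_scale s (cd_scale s p)" by (rule arg_cong)
    moreover have "s * s = 1" using that(2) by auto
    ultimately have "p = cd_scale (s * ?r) q" by (simp only: cd_scale_scale cd_scale_one)
    moreover have "s * ?r = 1 \<or> s * ?r = -1" using r that(2) by auto
    ultimately have "p = q \<or> p = cd_neg q" by (metis cd_scale_one)
    with \<open>p \<noteq> q\<close> \<open>p \<noteq> cd_neg q\<close> show False by blast
  qed
  from this[of 1] this[of "-1"] have "cd_conj (cd_mult \<gamma> k q p) = cd_neg (cd_mult \<gamma> k q p)"
    using cd_pm_E_real_or_imag[OF cd_mult_pm_E[OF \<gamma> q(1) p(1)]] by auto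
  with conj show ?thesis by simp
qed

section \<open>Existence of anticommuting and antiassociating basis elements\<close>

lemma cd_pm_E_anticommuting_exists:
  assumes \<gamma>: "range \<gamma> \<subseteq> {1, -1}" and p: "p \<in> cd_pm_E k" "cd_conj p = cd_neg p"
    and k: "k \<ge> 2"
  shows "\<exists>c\<in>cd_pm_E k. cd_conj c = cd_neg c \<and>
    cd_mult \<gamma> k p c = cd_neg (cd_mult \<gamma> k c p)"
proof -
  obtain l where l: "k = Suc (Suc l)" using le_Suc_ex[OF k] by auto
  \<comment> \<open>From level 2 on there are two imaginary basis elements with different nonzero
    components; p can agree up to sign with at most one of them and anticommutes with the
    other.\<close>
  let ?e = "CD_Pair (cd_zero (Suc l)) (cd_one (Suc l))"
  let ?f = "CD_Pair (CD_Pair (cd_zero l) (cd_one l)) (cd_zero (Suc l))"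
  have e: "?e \<in> cd_pm_E k" and f: "?f \<in> cd_pm_E k"
    unfolding l by (intro cd_pm_E_Pair_zero cd_pm_E_zero_Pair cd_one_pm_E)+
  have e': "cd_conj ?e = cd_neg ?e" and f': "cd_conj ?f = cd_neg ?f"
    by simp_all
  show ?thesis
  proof (cases "p = ?e \<or> p = cd_neg ?e")
    case False
    then have "p \<noteq> ?e" "p \<noteq> cd_neg ?e" by blast+
    from cd_pm_E_anticommute[OF \<gamma> p e e' this] e e' show ?thesis by (intro bexI conjI)
  next
    case True
    then obtain u v where "p = CD_Pair u v" "v = cd_one (Suc l) \<or> v = cd_neg (cd_one (Suc l))"
      unfolding cd_scale.simps by blast
    moreover from this(2) have "v \<noteq> cd_zero (Suc l)"
      by (metis cd_pm_E_neq_zero cd_neg_pm_E cd_one_pm_E)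
    ultimately have "p \<noteq> ?f" "p \<noteq> cd_neg ?f"
      by (simp_all only: cd_scale.simps cd_scale_zero cd.inject simp_thms not_False_eq_True)
    from cd_pm_E_anticommute[OF \<gamma> p f f' this] f f' show ?thesis by (intro bexI conjI)
  qed
qed

text \<open>Write a and b as pairs with a zero component. Unless both second components vanish, c is
  sought in the form (c, 0), and the claim becomes an identity one level down. That level is at
  least 2, so anticommuting partners exist there.\<close>

lemma cd_pm_E_antiassociating_exists:
  assumes \<gamma>: "range \<gamma> \<subseteq> {1, -1}" and k: "k \<ge> 3"
    and a: "a \<in> cd_pm_E k" "cd_conj a = cd_neg a"
    and b: "b \<in> cd_pm_E k" "cd_conj b = cd_neg b" and "a \<noteq> b" "a \<noteq> cd_neg b"
  shows "\<exists>c\<in>cd_pm_E k. cd_conj c = cd_neg c \<and>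
    cd_mult \<gamma> k (cd_mult \<gamma> k a c) b = cd_neg (cd_mult \<gamma> k a (cd_mult \<gamma> k c b))"
proof -
  obtain m where m: "k = Suc m" "m \<ge> 2" using k by (cases k) auto
  have ex: "\<exists>c\<in>cd_pm_E m. cd_conj c = cd_neg c \<and>
      cd_mult \<gamma> m p c = cd_neg (cd_mult \<gamma> m c p)"
    if "p \<in> cd_pm_E m" "cd_conj p = cd_neg p" for p
    using cd_pm_E_anticommuting_exists[OF \<gamma> that m(2)] .
  have lift: "CD_Pair c (cd_zero m) \<in> cd_pm_E k"
    "cd_conj (CD_Pair c (cd_zero m)) = cd_neg (CD_Pair c (cd_zero m))"
    if "c \<in> cd_pm_E m" "cd_conj c = cd_neg c" for c
    using that unfolding m by (auto simp: cd_pm_E_Suc)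
  note mults = cd_mult_Pair_zero_left cd_mult_zero_Pair_left
    cd_mult_Pair_zero_right cd_mult_zero_Pair_right
  note alt = cd_pm_E_alternative[OF \<gamma>]
  note anti = cd_pm_E_anticommute[OF \<gamma>]
  have one: "q = cd_one m \<or> q = cd_neg (cd_one m) \<or> cd_conj q = cd_neg q"
    if "q \<in> cd_pm_E m" for q
    using cd_pm_E_real_or_imag[OF that] .
  from a b m(1) consider
    (LL) p q where "a = CD_Pair p (cd_zero m)" "b = CD_Pair q (cd_zero m)"
      "p \<in> cd_pm_E m" "q \<in> cd_pm_E m"
  | (LR) p q where "a = CD_Pair p (cd_zero m)" "b = CD_Pair (cd_zero m) q"
      "p \<in> cd_pm_E m" "q \<in> cd_pm_E m"
  | (RL) p q where "a = CD_Pair (cd_zero m) p" "b = CD_Pair q (cd_zero m)"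
      "p \<in> cd_pm_E m" "q \<in> cd_pm_E m"
  | (RR) p q where "a = CD_Pair (cd_zero m) p" "b = CD_Pair (cd_zero m) q"
      "p \<in> cd_pm_E m" "q \<in> cd_pm_E m"
    by (auto simp: cd_pm_E_Suc)
  then show ?thesis
  proof cases
    case LL
    note [simp] = LL(3,4)[THEN cd_pm_E_carrier]
    have im: "cd_conj p = cd_neg p" "cd_conj q = cd_neg q" "p \<noteq> q" "p \<noteq> cd_neg q"
      using a(2) b(2) \<open>a \<noteq> b\<close> \<open>a \<noteq> cd_neg b\<close> LL by auto
    \<comment> \<open>With c = (0, 1) the two products are (0, -pq) and (0, -qp), so it suffices
      that p and q anticommute.\<close>
    let ?c = "CD_Pair (cd_zero m) (cd_one m)"
    have "?c \<in> cd_pm_E k" "cd_conj ?c = cd_neg ?c"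
      using cd_one_pm_E[of m] unfolding m by (auto simp: cd_pm_E_Suc)
    moreover have "cd_mult \<gamma> k (cd_mult \<gamma> k a ?c) b = cd_neg (cd_mult \<gamma> k a (cd_mult \<gamma> k ?c b))"
      using anti[OF LL(3) im(1) LL(4) im(2-4)] im
      unfolding m LL by (simp add: mults del: cd_mult.simps)
    ultimately show ?thesis by blast
  next
    case LR
    note [simp] = LR(3,4)[THEN cd_pm_E_carrier]
    have im: "cd_conj p = cd_neg p" using a(2) LR by auto
    have "\<exists>c\<in>cd_pm_E m. cd_conj c = cd_neg c \<and>
      cd_mult \<gamma> m q (cd_mult \<gamma> m p c) = cd_neg (cd_mult \<gamma> m (cd_mult \<gamma> m q c) p)"
    \<comment> \<open>If q is real or parallel to p, any c anticommuting with p works, in the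
      parallel case by flexibility. Otherwise c = q works: q(pq) = -q(qp) = n(q) p, while (qq)p =
      -n(q) p.\<close>
    proof (cases "q \<in> {cd_one m, cd_neg (cd_one m), p, cd_neg p}")
      case True
      from ex[OF LR(3) im] obtain c where c: "c \<in> cd_pm_E m" "cd_conj c = cd_neg c"
        "cd_mult \<gamma> m p c = cd_neg (cd_mult \<gamma> m c p)" by blast
      note [simp] = cd_pm_E_carrier[OF c(1)]
      have "cd_mult \<gamma> m p (cd_mult \<gamma> m c p) = cd_mult \<gamma> m (cd_mult \<gamma> m p c) p"
        using cd_pm_E_flexible[OF \<gamma> LR(3), of c] by simp
      with True c show ?thesis by (intro bexI[of _ c]) auto
    next
      case False
      then have q: "cd_conj q = cd_neg q" using one[OF LR(4)] by auto
      have "p \<noteq> q" "p \<noteq> cd_neg q" using False by auto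
      then have "cd_mult \<gamma> m p q = cd_neg (cd_mult \<gamma> m q p)"
        by (rule anti[OF LR(3) im LR(4) q])
      then show ?thesis using q LR(4)
        alt(2)[OF LR(4) q, of p] alt(1)[OF LR(4) q, of "cd_one m"]
        by (intro bexI[of _ q]) auto
    qed
    then obtain c where c: "c \<in> cd_pm_E m" "cd_conj c = cd_neg c"
      "cd_mult \<gamma> m q (cd_mult \<gamma> m p c) = cd_neg (cd_mult \<gamma> m (cd_mult \<gamma> m q c) p)" by blast
    have "cd_mult \<gamma> k (cd_mult \<gamma> k a (CD_Pair c (cd_zero m))) b =
        cd_neg (cd_mult \<gamma> k a (cd_mult \<gamma> k (CD_Pair c (cd_zero m)) b))"
      using c cd_pm_E_carrier[OF c(1)]
      unfolding m LR by (simp add: mults del: cd_mult.simps)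
    with lift[OF c(1,2)] show ?thesis by blast
  next
    case RL
    note [simp] = RL(3,4)[THEN cd_pm_E_carrier]
    have im: "cd_conj q = cd_neg q" using b(2) RL by auto
    have "\<exists>c\<in>cd_pm_E m. cd_conj c = cd_neg c \<and>
      cd_mult \<gamma> m (cd_mult \<gamma> m p c) q = cd_neg (cd_mult \<gamma> m p (cd_mult \<gamma> m q c))"
    \<comment> \<open>The previous choice with p and q exchanged: c anticommutes with q, or c =
      p.\<close>
    proof (cases "p \<in> {cd_one m, cd_neg (cd_one m), q, cd_neg q}")
      case True
      from ex[OF RL(4) im] obtain c where c: "c \<in> cd_pm_E m" "cd_conj c = cd_neg c"
        "cd_mult \<gamma> m q c = cd_neg (cd_mult \<gamma> m c q)" by blast
      note [simp] = cd_pm_E_carrier[OF c(1)]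
      have "cd_mult \<gamma> m q (cd_mult \<gamma> m c q) = cd_mult \<gamma> m (cd_mult \<gamma> m q c) q"
        using cd_pm_E_flexible[OF \<gamma> RL(4), of c] by simp
      with True c show ?thesis by (intro bexI[of _ c]) auto
    next
      case False
      then have p: "cd_conj p = cd_neg p" using one[OF RL(3)] by auto
      have "q \<noteq> p" "q \<noteq> cd_neg p" using False by auto
      then have "cd_mult \<gamma> m q p = cd_neg (cd_mult \<gamma> m p q)"
        by (rule anti[OF RL(4) im RL(3) p])
      then show ?thesis using p RL(3)
        alt(2)[OF RL(3) p, of q] alt(1)[OF RL(3) p, of "cd_one m"]
        by (intro bexI[of _ p]) auto
    qed
    then obtain c where c: "c \<in> cd_pm_E m" "cd_conj c = cd_neg c"
      "cd_mult \<gamma> m (cd_mult \<gamma> m p c) q = cd_neg (cd_mult \<gamma> m p (cd_mult \<gamma> m q c))" by blast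
    have "cd_mult \<gamma> k (cd_mult \<gamma> k a (CD_Pair c (cd_zero m))) b =
        cd_neg (cd_mult \<gamma> k a (cd_mult \<gamma> k (CD_Pair c (cd_zero m)) b))"
      using c im cd_pm_E_carrier[OF c(1)]
      unfolding m RL by (simp add: mults cd_conj_mult del: cd_mult.simps)
    with lift[OF c(1,2)] show ?thesis by blast
  next
    case RR
    note [simp] = RR(3,4)[THEN cd_pm_E_carrier]
    have pq: "p \<noteq> q" "p \<noteq> cd_neg q" "q \<noteq> cd_neg p"
      using \<open>a \<noteq> b\<close> \<open>a \<noteq> cd_neg b\<close> RR by auto
    have "\<exists>c\<in>cd_pm_E m. cd_conj c = cd_neg c \<and>
      cd_mult \<gamma> m (cd_conj q) (cd_mult \<gamma> m p c) =
        cd_neg (cd_mult \<gamma> m (cd_mult \<gamma> m c (cd_conj q)) p)"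
    \<comment> \<open>Here p and q are not parallel, so at most one of them is real. If one is, c
      anticommutes with the other; if none is, c = p works because p and q anticommute.\<close>
    proof (cases "p \<in> {cd_one m, cd_neg (cd_one m)}")
      case True
      then have q: "cd_conj q = cd_neg q" using one[OF RR(4)] pq by auto
      from ex[OF RR(4) q] obtain c where c: "c \<in> cd_pm_E m" "cd_conj c = cd_neg c"
        "cd_mult \<gamma> m q c = cd_neg (cd_mult \<gamma> m c q)" by blast
      with True q show ?thesis using cd_pm_E_carrier[OF c(1)] by (intro bexI[of _ c]) auto
    next
      case False
      then have p: "cd_conj p = cd_neg p" using one[OF RR(3)] by auto
      show ?thesis
      proof (cases "q \<in> {cd_one m, cd_neg (cd_one m)}")
        case True
        from ex[OF RR(3) p] obtain c where c: "c \<in> cd_pm_E m" "cd_conj c = cd_neg c"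
          "cd_mult \<gamma> m p c = cd_neg (cd_mult \<gamma> m c p)" by blast
        with True show ?thesis using cd_pm_E_carrier[OF c(1)] by (intro bexI[of _ c]) auto
      next
        case False
        then have q: "cd_conj q = cd_neg q" using one[OF RR(4)] by auto
        have "cd_mult \<gamma> m p q = cd_neg (cd_mult \<gamma> m q p)"
          using anti[OF RR(3) p RR(4) q] pq by auto
        then show ?thesis using p q RR(3)
          alt(1)[OF RR(3) p, of q] alt(1)[OF RR(3) p, of "cd_one m"]
          by (intro bexI[of _ p]) auto
      qed
    qed
    then obtain c where c: "c \<in> cd_pm_E m" "cd_conj c = cd_neg c"
      "cd_mult \<gamma> m (cd_conj q) (cd_mult \<gamma> m p c) =
        cd_neg (cd_mult \<gamma> m (cd_mult \<gamma> m c (cd_conj q)) p)" by blast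
    have "cd_mult \<gamma> k (cd_mult \<gamma> k a (CD_Pair c (cd_zero m))) b =
        cd_neg (cd_mult \<gamma> k a (cd_mult \<gamma> k (CD_Pair c (cd_zero m)) b))"
      using c cd_pm_E_carrier[OF c(1)]
      unfolding m RR by (simp add: mults cd_conj_mult del: cd_mult.simps)
    with lift[OF c(1,2)] show ?thesis by blast
  qed
qed

subsection \<open>Zero divisors\<close>

text \<open>Level 2 is a generalized quaternion algebra; associativity is checked there in its four
  real coordinates.\<close>

lemma cd_mult_assoc_le_2:
  assumes "k \<le> 2" "x \<in> cd_carrier k" "y \<in> cd_carrier k" "z \<in> cd_carrier k"
  shows "cd_mult \<gamma> k (cd_mult \<gamma> k x y) z = cd_mult \<gamma> k x (cd_mult \<gamma> k y z)"
proof -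
  consider "k = 0" | "k = Suc 0" | "k = Suc (Suc 0)" using assms(1) by linarith
  then show ?thesis
  proof cases
    assume "k = 0"
    then show ?thesis using assms(2-) by auto
  next
    assume "k = Suc 0"
    then show ?thesis using assms(2-) by (auto simp: algebra_simps)
  next
    assume k: "k = Suc (Suc 0)"
    have "\<exists>p q r s. w = CD_Pair (CD_Pair (CD_Real p) (CD_Real q)) (CD_Pair (CD_Real r) (CD_Real s))"
      if "w \<in> cd_carrier k" for w
      using that unfolding k by auto
    with assms(2-) obtain x1 x2 x3 x4 y1 y2 y3 y4 z1 z2 z3 z4 where
      "x = CD_Pair (CD_Pair (CD_Real x1) (CD_Real x2)) (CD_Pair (CD_Real x3) (CD_Real x4))"
      "y = CD_Pair (CD_Pair (CD_Real y1) (CD_Real y2)) (CD_Pair (CD_Real y3) (CD_Real y4))"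
      "z = CD_Pair (CD_Pair (CD_Real z1) (CD_Real z2)) (CD_Pair (CD_Real z3) (CD_Real z4))"
      by metis
    then show ?thesis
      unfolding k by (simp only: cd_mult.simps cd_conj.simps cd_add.simps cd_scale.simps cd.inject) (simp add: algebra_simps)
  qed
qed

text \<open>Reduces the question to the two component equations of (a, b)(c, d) = 0; each case below
  either exhibits a nonzero solution or shows that there is none.\<close>

lemma cd_zero_divisor_pm_E_iff:
  assumes a: "a \<in> cd_pm_E k" "cd_conj a = cd_neg a" and b: "b \<in> cd_pm_E k"
  shows "cd_zero_divisor \<gamma> (Suc k) (CD_Pair a b) \<longleftrightarrow>
    (\<exists>c\<in>cd_carrier k. \<exists>d\<in>cd_carrier k. (c \<noteq> cd_zero k \<or> d \<noteq> cd_zero k) \<and>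
      cd_mult \<gamma> k a c = cd_scale (- \<gamma> k) (cd_mult \<gamma> k (cd_conj d) b) \<and>
      cd_mult \<gamma> k d a = cd_neg (cd_mult \<gamma> k b (cd_conj c)))"
    (is "?l \<longleftrightarrow> ?r")
proof -
  note [simp] = cd_pm_E_carrier[OF a(1)] cd_pm_E_carrier[OF b]
  let ?x = "CD_Pair a b"
  have x: "?x \<in> cd_carrier (Suc k)" "?x \<noteq> cd_zero (Suc k)" "cd_conj ?x = cd_neg ?x"
    using cd_pm_E_neq_zero[OF a(1)] a(2) by auto
  \<comment> \<open>Since \<open>x\<close> is imaginary, conjugation exchanges its left and right annihilators.\<close>
  have swap: "cd_mult \<gamma> (Suc k) ?x (cd_conj y) = cd_zero (Suc k)"
    if "y \<in> cd_carrier (Suc k)" "cd_mult \<gamma> (Suc k) y ?x = cd_zero (Suc k)" for y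
  proof -
    have "cd_neg (cd_mult \<gamma> (Suc k) ?x (cd_conj y)) = cd_conj (cd_mult \<gamma> (Suc k) y ?x)"
      using that(1) x by (simp only: cd_conj_mult cd_mult_scale_left cd_conj_carrier)
    also have "\<dots> = cd_zero (Suc k)" using that(2) by (simp only: cd_conj_zero)
    finally show ?thesis
      using that(1) x(1) cd_scale_eq_zero_iff[of _ "Suc k" "-1"] cd_mult_carrier cd_conj_carrier
      by (metis neg_equal_0_iff_equal zero_neq_one)
  qed
  have "?l \<longleftrightarrow> (\<exists>y\<in>cd_carrier (Suc k). y \<noteq> cd_zero (Suc k) \<and>
      cd_mult \<gamma> (Suc k) ?x y = cd_zero (Suc k))"
    unfolding cd_zero_divisor_def
    using x(1,2) swap cd_conj_carrier[of _ "Suc k"] cd_conj_eq_zero_iff[of _ "Suc k"] by blast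
  also have "\<dots> \<longleftrightarrow> (\<exists>c\<in>cd_carrier k. \<exists>d\<in>cd_carrier k. (c \<noteq> cd_zero k \<or> d \<noteq> cd_zero k) \<and>
      cd_mult \<gamma> (Suc k) ?x (CD_Pair c d) = cd_zero (Suc k))"
    by (simp del: cd_mult.simps) blast
  also have "\<dots> \<longleftrightarrow> ?r"
    by (intro bex_cong conj_cong refl) (simp add: cd_add_eq_zero_iff)
  finally show ?thesis .
qed

lemma cd_E_real_or_imag: "p \<in> cd_E k \<Longrightarrow> p = cd_one k \<or> cd_conj p = cd_neg p"
proof (induction k arbitrary: p)
  case (Suc k)
  then show ?case by (fastforce simp: cd_E_Suc)
qed (auto simp: cd_E_def)

lemma cd_norm_neg: "p \<in> cd_carrier k \<Longrightarrow> cd_norm \<gamma> k (cd_neg p) = cd_norm \<gamma> k p"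
  by (simp add: cd_norm_def)

lemma cd_norm_one: "cd_norm \<gamma> k (cd_one k) = 1"
  unfolding cd_norm_def
proof (rule the_equality)
  fix r
  assume "cd_mult \<gamma> k (cd_one k) (cd_conj (cd_one k)) = cd_scale r (cd_one k)"
  then have "cd_scale 1 (cd_one k) = cd_scale r (cd_one k)" by simp
  then show "r = 1" by (subst (asm) cd_scale_cancel_left[where k = k]) auto
qed simp

text \<open>A second multiplication by a yields -n(a) x, and n(a) is its own reciprocal.\<close>

lemma cd_pm_E_solve_left:
  assumes \<gamma>: "range \<gamma> \<subseteq> {1, -1}" and a: "a \<in> cd_pm_E k" "cd_conj a = cd_neg a"
    and x: "x \<in> cd_carrier k" "cd_mult \<gamma> k a x = y"
  shows "x = cd_scale (- cd_norm \<gamma> k a) (cd_mult \<gamma> k a y)"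
proof -
  have "cd_mult \<gamma> k a y = cd_scale (- cd_norm \<gamma> k a) x"
    using x cd_pm_E_alternative(2)[OF \<gamma> a, of x] by simp
  then show ?thesis
    using cd_norm_pm_E(1)[OF \<gamma> a(1)] by auto
qed

lemma cd_pm_E_solve_right:
  assumes \<gamma>: "range \<gamma> \<subseteq> {1, -1}" and a: "a \<in> cd_pm_E k" "cd_conj a = cd_neg a"
    and x: "x \<in> cd_carrier k" "cd_mult \<gamma> k x a = y"
  shows "x = cd_scale (- cd_norm \<gamma> k a) (cd_mult \<gamma> k y a)"
proof -
  have "cd_mult \<gamma> k y a = cd_scale (- cd_norm \<gamma> k a) x"
    using x cd_pm_E_alternative(1)[OF \<gamma> a, of x] by simp
  then show ?thesis
    using cd_norm_pm_E(1)[OF \<gamma> a(1)] by auto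
qed

section \<open>Solving the component equations case by case\<close>

context
  fixes \<gamma> :: "nat \<Rightarrow> real" and k :: nat and a b :: cd
  assumes \<gamma>: "range \<gamma> \<subseteq> {1, -1}"
    and a: "a \<in> cd_pm_E k" "cd_conj a = cd_neg a" and b: "b \<in> cd_pm_E k"
begin

lemma cd_components_carrier: "a \<in> cd_carrier k" "b \<in> cd_carrier k"
  using a(1) b by (simp_all add: cd_pm_E_carrier)

lemma cd_zero_divisor_if_isotropic:
  assumes "cd_norm \<gamma> k a = \<gamma> k * cd_norm \<gamma> k b"
  shows "cd_zero_divisor \<gamma> (Suc k) (CD_Pair a b)"
proof -
  note [simp] = cd_components_carrier
  have "cd_mult \<gamma> k a a = cd_scale (- cd_norm \<gamma> k a) (cd_one k)"
    using cd_pm_E_alternative(1)[OF \<gamma> a, of "cd_one k"] by simp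
  moreover have "cd_mult \<gamma> k (cd_conj b) b = cd_scale (cd_norm \<gamma> k b) (cd_one k)"
    using cd_norm_pm_E(3)[OF \<gamma> b, of "cd_one k"] by simp
  \<comment> \<open>The witness is (a, b) itself, the negative of its conjugate. The first equation
    becomes n(a) = \<open>\<gamma> k\<close> n(b), and the second holds because conj a = -a.\<close>
  ultimately show ?thesis
    unfolding cd_zero_divisor_pm_E_iff[OF a b]
    using cd_pm_E_neq_zero[OF a(1)] assms a(2)
    by (intro bexI[of _ a] bexI[of _ b]) auto
qed

lemma cd_zero_divisor_if_generic:
  assumes "k \<ge> 3" and b': "cd_conj b = cd_neg b" and "a \<noteq> b" "a \<noteq> cd_neg b"
    and \<chi>: "\<gamma> k * cd_norm \<gamma> k a * cd_norm \<gamma> k b = -1"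
  shows "cd_zero_divisor \<gamma> (Suc k) (CD_Pair a b)"
proof -
  note [simp] = cd_components_carrier
  obtain c where c: "c \<in> cd_pm_E k" "cd_conj c = cd_neg c"
    and anti: "cd_mult \<gamma> k (cd_mult \<gamma> k a c) b = cd_neg (cd_mult \<gamma> k a (cd_mult \<gamma> k c b))"
    using cd_pm_E_antiassociating_exists[OF \<gamma> assms(1) a b assms(2-4)] by blast
  note [simp] = cd_pm_E_carrier[OF c(1)]
  \<comment> \<open>The second equation reads da = bc, which determines d. Its conjugate is n(a)
    a(cb), so the first equation concerns (a(cb))b, where antiassociativity lets the two factors b
    collapse to a scalar.\<close>
  let ?d = "cd_scale (- cd_norm \<gamma> k a) (cd_mult \<gamma> k (cd_mult \<gamma> k b c) a)"
  have sq: "cd_norm \<gamma> k a * cd_norm \<gamma> k a = 1"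
    using cd_norm_pm_E(1)[OF \<gamma> a(1)] by auto
  have "cd_mult \<gamma> k (cd_mult \<gamma> k a (cd_mult \<gamma> k c b)) b =
      cd_neg (cd_mult \<gamma> k (cd_mult \<gamma> k (cd_mult \<gamma> k a c) b) b)"
    by (simp add: anti)
  also have "\<dots> = cd_scale (cd_norm \<gamma> k b) (cd_mult \<gamma> k a c)"
    by (simp add: cd_pm_E_alternative(1)[OF \<gamma> b b'])
  finally have "cd_mult \<gamma> k (cd_conj ?d) b =
      cd_scale (cd_norm \<gamma> k a * cd_norm \<gamma> k b) (cd_mult \<gamma> k a c)"
    using a b' c by (simp add: cd_conj_mult)
  then have "cd_mult \<gamma> k a c = cd_scale (- \<gamma> k) (cd_mult \<gamma> k (cd_conj ?d) b)"
    using \<chi> by (simp add: mult.assoc)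
  moreover have "cd_mult \<gamma> k ?d a = cd_neg (cd_mult \<gamma> k b (cd_conj c))"
    using c(2) sq by (simp add: cd_pm_E_alternative(1)[OF \<gamma> a])
  ultimately show ?thesis
    unfolding cd_zero_divisor_pm_E_iff[OF a b]
    using cd_pm_E_neq_zero[OF c(1)] by (intro bexI[of _ c] bexI[of _ ?d]) auto
qed

text \<open>Substitute the solution for c of the first equation into the second. Associativity
  brings b next to its conjugate, and the remaining scalar -\<open>\<gamma> k\<close> n(a) n(b) is
  1, whence da = -da.\<close>

lemma cd_not_zero_divisor_le_2:
  assumes "k \<le> 2" and \<chi>: "\<gamma> k * cd_norm \<gamma> k a * cd_norm \<gamma> k b = -1"
  shows "\<not> cd_zero_divisor \<gamma> (Suc k) (CD_Pair a b)"
proof -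
  note [simp] = cd_components_carrier
  have "c = cd_zero k \<and> d = cd_zero k"
    if [simp]: "c \<in> cd_carrier k" "d \<in> cd_carrier k"
      and ac: "cd_mult \<gamma> k a c = cd_scale (- \<gamma> k) (cd_mult \<gamma> k (cd_conj d) b)"
      and da: "cd_mult \<gamma> k d a = cd_neg (cd_mult \<gamma> k b (cd_conj c))" for c d
  proof -
    have c: "c = cd_scale (cd_norm \<gamma> k a * \<gamma> k) (cd_mult \<gamma> k a (cd_mult \<gamma> k (cd_conj d) b))"
      using cd_pm_E_solve_left[OF \<gamma> a _ ac] by simp
    have "cd_mult \<gamma> k b (cd_conj c) = cd_scale (- (cd_norm \<gamma> k a * \<gamma> k))
        (cd_mult \<gamma> k b (cd_mult \<gamma> k (cd_mult \<gamma> k (cd_conj b) d) a))"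
      unfolding c by (simp add: cd_conj_mult a(2))
    also have "\<dots> = cd_scale (- (cd_norm \<gamma> k a * \<gamma> k))
        (cd_mult \<gamma> k (cd_mult \<gamma> k b (cd_mult \<gamma> k (cd_conj b) d)) a)"
      using assms(1) by (simp add: cd_mult_assoc_le_2)
    also have "\<dots> = cd_mult \<gamma> k d a"
      using \<chi> by (simp add: cd_norm_pm_E(5)[OF \<gamma> b] algebra_simps)
    finally have "cd_mult \<gamma> k d a = cd_neg (cd_mult \<gamma> k d a)" using da by simp
    then have "cd_mult \<gamma> k d a = cd_zero k" by (simp add: cd_neg_eq_self_iff[where k = k])
    from cd_pm_E_solve_right[OF \<gamma> a _ this] have "d = cd_zero k" by simp
    with c show ?thesis by simp
  qed
  then show ?thesis unfolding cd_zero_divisor_pm_E_iff[OF a b] by blast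
qed

text \<open>After conjugation of the second equation both equations involve conj d. Flexibility
  combines them into a(ac) = -(ca)a, whereas a(ac) and (ca)a both equal -n(a) c.\<close>

lemma cd_not_zero_divisor_parallel:
  assumes b_eq: "b = cd_scale s a" "s \<in> {1, -1}" and "\<gamma> k = -1"
  shows "\<not> cd_zero_divisor \<gamma> (Suc k) (CD_Pair a b)"
proof -
  note [simp] = cd_components_carrier(1)
  have "c = cd_zero k \<and> d = cd_zero k"
    if [simp]: "c \<in> cd_carrier k" "d \<in> cd_carrier k"
      and "cd_mult \<gamma> k a c = cd_scale (- \<gamma> k) (cd_mult \<gamma> k (cd_conj d) b)"
      and "cd_mult \<gamma> k d a = cd_neg (cd_mult \<gamma> k b (cd_conj c))" for c d
  proof -
    have ac: "cd_mult \<gamma> k a c = cd_scale s (cd_mult \<gamma> k (cd_conj d) a)"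
      and da: "cd_mult \<gamma> k d a = cd_scale (- s) (cd_mult \<gamma> k a (cd_conj c))"
      using that assms by simp_all
    have "cd_neg (cd_mult \<gamma> k a (cd_conj d)) = cd_conj (cd_mult \<gamma> k d a)"
      by (simp add: cd_conj_mult a(2))
    also have "\<dots> = cd_scale s (cd_mult \<gamma> k c a)"
      unfolding da by (simp add: cd_conj_mult a(2))
    finally have "cd_neg (cd_neg (cd_mult \<gamma> k a (cd_conj d))) =
        cd_neg (cd_scale s (cd_mult \<gamma> k c a))" by (rule arg_cong)
    then have ad: "cd_mult \<gamma> k a (cd_conj d) = cd_scale (- s) (cd_mult \<gamma> k c a)" by simp
    have "cd_mult \<gamma> k a (cd_mult \<gamma> k a c) =
        cd_scale s (cd_mult \<gamma> k (cd_mult \<gamma> k a (cd_conj d)) a)"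
      unfolding ac by (simp add: cd_pm_E_flexible[OF \<gamma> a(1)])
    also have "\<dots> = cd_neg (cd_mult \<gamma> k (cd_mult \<gamma> k c a) a)"
      unfolding ad using assms(2) by auto
    also have "\<dots> = cd_neg (cd_mult \<gamma> k a (cd_mult \<gamma> k a c))"
      by (simp only: cd_pm_E_alternative[OF \<gamma> a \<open>c \<in> cd_carrier k\<close>])
    finally have "cd_mult \<gamma> k a (cd_mult \<gamma> k a c) = cd_zero k"
      by (rule iffD1[OF cd_neg_eq_self_iff, rotated]) simp
    from cd_pm_E_solve_left[OF \<gamma> a _ this] have "cd_mult \<gamma> k a c = cd_zero k" by simp
    from cd_pm_E_solve_left[OF \<gamma> a _ this] have c: "c = cd_zero k" by simp
    with da have "cd_mult \<gamma> k d a = cd_zero k" by simp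
    from cd_pm_E_solve_right[OF \<gamma> a _ this] c show ?thesis by simp
  qed
  then show ?thesis unfolding cd_zero_divisor_pm_E_iff[OF a b] by blast
qed

text \<open>As b is a real scalar, the first equation gives c as a multiple of a(conj d), and the
  conjugated second equation turns this into c = -c.\<close>

lemma cd_not_zero_divisor_real:
  assumes b_eq: "b = cd_scale s (cd_one k)" "s \<in> {1, -1}" and \<chi>: "\<gamma> k * cd_norm \<gamma> k a = -1"
  shows "\<not> cd_zero_divisor \<gamma> (Suc k) (CD_Pair a b)"
proof -
  note [simp] = cd_components_carrier(1)
  have "c = cd_zero k \<and> d = cd_zero k"
    if [simp]: "c \<in> cd_carrier k" "d \<in> cd_carrier k"
      and "cd_mult \<gamma> k a c = cd_scale (- \<gamma> k) (cd_mult \<gamma> k (cd_conj d) b)"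
      and "cd_mult \<gamma> k d a = cd_neg (cd_mult \<gamma> k b (cd_conj c))" for c d
  proof -
    have ac: "cd_mult \<gamma> k a c = cd_scale (- (\<gamma> k * s)) (cd_conj d)"
      and da: "cd_mult \<gamma> k d a = cd_scale (- s) (cd_conj c)"
      using that assms by simp_all
    have "c = cd_scale (cd_norm \<gamma> k a * \<gamma> k * s) (cd_mult \<gamma> k a (cd_conj d))"
      using cd_pm_E_solve_left[OF \<gamma> a _ ac] by (simp add: mult.assoc)
    also have "\<dots> = cd_scale (- s) (cd_mult \<gamma> k a (cd_conj d))"
      using \<chi> by (simp add: mult.commute)
    also have "\<dots> = cd_scale s (cd_conj (cd_mult \<gamma> k d a))"
      by (simp add: cd_conj_mult a(2))
    also have "\<dots> = cd_neg c" unfolding da using assms(2) by auto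
    finally have c: "c = cd_zero k" by (simp only: cd_neg_eq_self_iff[OF that(1)])
    with da have "cd_mult \<gamma> k d a = cd_zero k" by simp
    from cd_pm_E_solve_right[OF \<gamma> a _ this] c show ?thesis by simp
  qed
  then show ?thesis unfolding cd_zero_divisor_pm_E_iff[OF a b] by blast
qed

end

theorem theorem6p16:
  fixes \<gamma> :: "nat \<Rightarrow> real" and n :: nat and a b :: cd and \<chi> :: real
  assumes "\<And>k. \<gamma> k \<in> {1, -1}"
    and "n \<ge> 1"
    and "a \<in> cd_E' n"
    and "b \<in> cd_pm_E n"
    and "\<chi> = \<gamma> n * (cd_norm \<gamma> n a / cd_norm \<gamma> n b)"
  shows "\<chi> \<in> {1, -1} \<and>
    (cd_zero_divisor \<gamma> (n + 1) (CD_Pair a b) \<longleftrightarrow>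
       \<not> ((n \<le> 2 \<and> \<chi> = -1)
         \<or> ((b = a \<or> b = cd_neg a) \<and> \<chi> = -1 \<and> \<gamma> n = -1)
         \<or> ((b = cd_one n \<or> b = cd_neg (cd_one n)) \<and> \<chi> = -1 \<and> \<gamma> n * cd_norm \<gamma> n a = -1)))"
proof -
  have \<gamma>: "range \<gamma> \<subseteq> {1, -1}" using assms(1) by blast
  have a: "a \<in> cd_pm_E n" "cd_conj a = cd_neg a"
    using assms(3) cd_E_real_or_imag[of a n] by (auto simp: cd_E'_def cd_pm_E_def)
  note b = assms(4)
    have na: "cd_norm \<gamma> n a \<in> {1, -1}" and nb: "cd_norm \<gamma> n b \<in> {1, -1}"
    using cd_norm_pm_E(1)[OF \<gamma>] a b by auto
  have \<chi>: "\<chi> = \<gamma> n * cd_norm \<gamma> n a * cd_norm \<gamma> n b"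
    using nb assms(5) by auto
  have \<chi>1: "\<chi> \<in> {1, -1}"
    using \<chi> na nb assms(1)[of n] by auto
  \<comment> \<open>For b parallel to a the norms cancel, and for b real n(b) = 1. So in exceptions
    (2) and (3) the additional sign condition already follows from \<open>\<chi>\<close> = -1, and
    the three exceptions merge.\<close>
  have par: "\<gamma> n = \<chi>" if "b = a \<or> b = cd_neg a"
    using that \<chi> na cd_norm_neg[OF cd_pm_E_carrier[OF a(1)]] by auto
  have real: "\<gamma> n * cd_norm \<gamma> n a = \<chi>" if "b = cd_one n \<or> b = cd_neg (cd_one n)"
    using that \<chi> cd_norm_neg[OF cd_basis_carrier] by (auto simp: cd_norm_one)
  have "cd_zero_divisor \<gamma> (Suc n) (CD_Pair a b) \<longleftrightarrow>
    \<not> (\<chi> = -1 \<and> (n \<le> 2 \<or> b = a \<or> b = cd_neg a \<or> b = cd_one n \<or> b = cd_neg (cd_one n)))"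
  proof (cases "\<chi> = 1")
    case True
    then have "cd_norm \<gamma> n a = \<gamma> n * cd_norm \<gamma> n b"
      using \<chi> na nb assms(1)[of n] by auto
    with True show ?thesis using cd_zero_divisor_if_isotropic[OF \<gamma> a b] by auto
  next
    case False
    then have \<chi>': "\<chi> = -1" using \<chi>1 by auto
    consider "n \<le> 2" | s where "b = cd_scale s a" "s \<in> {1, -1}"
      | s where "b = cd_scale s (cd_one n)" "s \<in> {1, -1}"
      | "n \<ge> 3" "b \<notin> {a, cd_neg a, cd_one n, cd_neg (cd_one n)}"
      by (cases "n \<le> 2") (auto, metis cd_scale_one)
    then show ?thesis
    proof cases
      case 1
      then show ?thesis using cd_not_zero_divisor_le_2[OF \<gamma> a b] \<chi> \<chi>' by simp
    next
      case 2
      then have "\<gamma> n = -1" using par \<chi>' by auto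
      with 2 cd_not_zero_divisor_parallel[OF \<gamma> a b 2] \<chi>' show ?thesis by auto
    next
      case 3
      then have "\<gamma> n * cd_norm \<gamma> n a = -1" using real \<chi>' by auto
      with 3 cd_not_zero_divisor_real[OF \<gamma> a b 3] \<chi>' show ?thesis by auto
    next
      case 4
      then have "cd_conj b = cd_neg b" using cd_pm_E_real_or_imag[OF b] by auto
      moreover have "a \<noteq> b" "a \<noteq> cd_neg b" using 4 by auto
      ultimately have "cd_zero_divisor \<gamma> (Suc n) (CD_Pair a b)"
        using cd_zero_divisor_if_generic[OF \<gamma> a b 4(1)] \<chi> \<chi>' by simp
      with 4 show ?thesis by auto
    qed
  qed
  with \<chi>1 par real show ?thesis by auto
qed

end
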